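(* There exist a stationary ergodic real-valued process $\{X_i\}_{i=-\infty}^{\infty}$ whose marginal distribution is uniform on $[0,1)$, and a sequence of partitions $\mathcal{P}_n=\{A_{n,j}\}_j$ of the real line satisfying, for every bounded interval $S$ symmetric around $0$, $$\lim_{n\to\infty}\ \sup_{j:\,A_{n,j}\cap S\neq\emptyset}\operatorname{diam}(A_{n,j})=0 \qquad\text{and}\qquad \lim_{n\to\infty}\frac{|\{j: A_{n,j}\cap S\neq\emptyset\}|}{n}=0,$$ such that, with $m(x)=E(X_0\mid X_{-1}=x)$, with $\hat m_n$ the partitioning estimate built from $\{X_i\}$ and $\mathcal{P}_n$, and with $\mu$ the Lebesgue measure on $[0,1)$, for all sufficiently large $n$, $$P\Bigl(\int \bigl|\hat m_n(x)-m(x)\bigr|\,\mu(dx)\ge \tfrac{1}{16}\Bigr)\ge \tfrac18 .$$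
   Context: Partitions of the real line are into Borel sets. For a partition $\mathcal{P}_n=\{A_{n,j}\}_j$ of $\mathbb{R}$, $A_n(x)$ denotes the cell $A_{n,j}$ of $\mathcal{P}_n$ into which $x$ falls. For a stationary real-valued process $\{X_i\}_{i=-\infty}^{\infty}$ and $n\ge 2$, the partitioning estimate of the autoregression function $m(x)=E(X_0\mid X_{-1}=x)$ based on the data $X_{-n},\dots,X_{-1}$ is $$\hat m_n(x)=\frac{\sum_{i=1}^{n-1} I_{[X_{-1-i}\in A_n(x)]}\,X_{-i}}{\sum_{i=1}^{n-1} I_{[X_{-1-i}\in A_n(x)]}},$$ with the convention $0/0=0$, where $I_{[\cdot]}$ is the indicator. Cells $A_{n,j}$ need not be intervals. $\operatorname{diam}(A)=\sup_{x,y\in A}|x-y|$, and $|\{\cdot\}|$ denotes cardinality. The measure $\mu$ (Lebesgue measure on $[0,1)$) is the common marginal distribution of the $X_i$. *)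

theory Defs
  imports "HOL-Probability.Probability"
begin

abbreviation path_space :: "(int \<Rightarrow> real) measure" where
  "path_space \<equiv> (\<Pi>\<^sub>M i\<in>UNIV. borel)"

definition real_process :: "'w measure \<Rightarrow> (int \<Rightarrow> 'w \<Rightarrow> real) \<Rightarrow> bool" where
  "real_process M X \<longleftrightarrow> prob_space M \<and> (\<forall>i. X i \<in> borel_measurable M)"

definition stationary_process :: "'w measure \<Rightarrow> (int \<Rightarrow> 'w \<Rightarrow> real) \<Rightarrow> bool" where
  "stationary_process M X \<longleftrightarrow>
     (\<forall>k. distr M path_space (\<lambda>\<omega> i. X (i + k) \<omega>) = distr M path_space (\<lambda>\<omega> i. X i \<omega>))"

definition ergodic_process :: "'w measure \<Rightarrow> (int \<Rightarrow> 'w \<Rightarrow> real) \<Rightarrow> bool" where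
  "ergodic_process M X \<longleftrightarrow>
     (\<forall>B\<in>sets path_space. (\<lambda>z i. z (i + 1)) -` B = B \<longrightarrow>
        \<P>(\<omega> in M. (\<lambda>i. X i \<omega>) \<in> B) \<in> {0, 1})"

abbreviation unif01 :: "real measure" where
  "unif01 \<equiv> uniform_measure lborel {0..<1}"

text \<open>
  \<open>m\<close> is a version of the regression function \<open>x \<mapsto> E(X\<^sub>0 | X\<^sub>-\<^sub>1 = x)\<close>. Versions agree almost
  everywhere with respect to the law of \<open>X\<^sub>-\<^sub>1\<close>. Meaningful for integrable \<open>X 0\<close>.
\<close>

definition autoregression_function ::
    "'w measure \<Rightarrow> (int \<Rightarrow> 'w \<Rightarrow> real) \<Rightarrow> (real \<Rightarrow> real) \<Rightarrow> bool" where
  "autoregression_function M X m \<longleftrightarrow>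
     m \<in> borel_measurable borel \<and>
     (AE \<omega> in M. real_cond_exp M (vimage_algebra (space M) (X (-1)) borel) (X 0) \<omega>
                   = m (X (-1) \<omega>))"


definition borel_partition :: "real set set \<Rightarrow> bool" where
  "borel_partition Q \<longleftrightarrow> partition_on UNIV Q \<and> countable Q \<and> Q \<subseteq> sets borel"

definition cell :: "real set set \<Rightarrow> real \<Rightarrow> real set" where
  "cell Q x = (THE A. A \<in> Q \<and> x \<in> A)"

definition cells_meeting :: "real set set \<Rightarrow> real set \<Rightarrow> real set set" where
  "cells_meeting Q S = {A \<in> Q. A \<inter> S \<noteq> {}}"

text \<open>
  The library's \<^const>\<open>diameter\<close> is unspecified on unbounded sets, and cells may be unbounded,
  so the diameter is taken in \<open>[0, \<infinity>]\<close>.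
\<close>

definition ediam :: "real set \<Rightarrow> ennreal" where
  "ediam A = (SUP x\<in>A. SUP y\<in>A. ennreal \<bar>x - y\<bar>)"

definition symmetric_bounded_interval :: "real set \<Rightarrow> bool" where
  "symmetric_bounded_interval S \<longleftrightarrow> is_interval S \<and> bounded S \<and> (\<forall>x\<in>S. - x \<in> S)"

text \<open>
  Since \<^const>\<open>card\<close> is \<open>0\<close> on infinite sets, the second condition states explicitly that
  the counts are eventually finite.
\<close>

definition shrinking_partitions :: "(nat \<Rightarrow> real set set) \<Rightarrow> bool" where
  "shrinking_partitions \<Q> \<longleftrightarrow>
     (\<forall>S. symmetric_bounded_interval S \<longrightarrow>
        (\<lambda>n. SUP A\<in>cells_meeting (\<Q> n) S. ediam A) \<longlonglongrightarrow> 0 \<and>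
        (\<forall>\<^sub>F n in sequentially. finite (cells_meeting (\<Q> n) S)) \<and>
        (\<lambda>n. real (card (cells_meeting (\<Q> n) S)) / real n) \<longlonglongrightarrow> 0)"

text \<open>
  Here \<open>z\<close> is a realization of the process; only \<open>z (-n), \<dots>, z (-1)\<close> are used. The convention
  \<open>0 / 0 = 0\<close> is that of HOL.
\<close>

definition partitioning_estimate ::
    "real set set \<Rightarrow> nat \<Rightarrow> (int \<Rightarrow> real) \<Rightarrow> real \<Rightarrow> real" where
  "partitioning_estimate Q n z x =
     (\<Sum>i=1..n-1. indicator (cell Q x) (z (-1 - int i)) * z (- int i)) /
     (\<Sum>i=1..n-1. indicator (cell Q x) (z (-1 - int i)))"

end

theory Submission
  imports Defs "HOL-Real_Asymp.Real_Asymp"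
begin

text \<open>
  The process is the rotation of the circle by an irrational \<open>\<alpha>\<close>, started at a uniform point, so that
  \<open>m x = frac (x + \<alpha>)\<close>. By Dirichlet's theorem there is \<open>q = q\<^sub>n\<close> for which \<open>q \<alpha>\<close> is within \<open>1/(8n)\<close> of
  an integer. Let \<open>E = {x. frac (q x) < 1/2}\<close>, and split the intervals of length \<open>1 / sqrt n\<close> into
  their intersections with \<open>E\<close> and with its complement. With probability at least \<open>1/4\<close> the whole
  sample of size \<open>n\<close> avoids \<open>E\<close>, and then the estimate vanishes on \<open>E\<close>, a set of measure \<open>1/2\<close>.

  Ergodicity: an invariant event corresponds to a Borel set of reals with the periods \<open>1\<close> and \<open>\<alpha>\<close>,
  hence with arbitrarily small periods. Such a set has the same density in all intervals, so
  it is null or conull.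
\<close>

section \<open>Lebesgue measure of periodic sets\<close>

lemma emeasure_lborel_periodic_shift:
  fixes P :: "real set"
  assumes "P \<in> sets borel" and "\<And>x. x + t \<in> P \<longleftrightarrow> x \<in> P"
  shows "emeasure lborel (P \<inter> {a + t..<b + t}) = emeasure lborel (P \<inter> {a..<b})"
proof -
  have "emeasure lborel (P \<inter> {a + t..<b + t})
      = emeasure (distr lborel borel ((+) t)) (P \<inter> {a + t..<b + t})"
    by (simp add: lborel_distr_plus)
  also have "\<dots> = emeasure lborel ((+) t -` (P \<inter> {a + t..<b + t}))"
    using assms(1) by (subst emeasure_distr) auto
  also have "(+) t -` (P \<inter> {a + t..<b + t}) = P \<inter> {a..<b}"
    by (auto simp: assms(2) add.commute[of t])
  finally show ?thesis .
qed

lemma periodic_of_int: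
  fixes P :: "real set" and k :: int
  assumes "\<And>x. x + p \<in> P \<longleftrightarrow> x \<in> P"
  shows "x + of_int k * p \<in> P \<longleftrightarrow> x \<in> P"
proof -
  have nat: "y + of_nat n * p \<in> P \<longleftrightarrow> y \<in> P" for y n
  proof (induction n)
    case (Suc n)
    then show ?case
      using assms[of "y + of_nat n * p"] by (simp add: algebra_simps)
  qed simp
  show ?thesis
  proof (cases "k \<ge> 0")
    case True
    then show ?thesis using nat[of x "nat k"] by simp
  next
    case False
    then show ?thesis using nat[of "x + of_int k * p" "nat (- k)"] by simp
  qed
qed

lemma emeasure_lborel_split:
  fixes P :: "real set"
  assumes "P \<in> sets borel" "a \<le> b" "b \<le> c"
  shows "emeasure lborel (P \<inter> {a..<c})
       = emeasure lborel (P \<inter> {a..<b}) + emeasure lborel (P \<inter> {b..<c})"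
proof -
  have "emeasure lborel (P \<inter> {a..<b}) + emeasure lborel (P \<inter> {b..<c})
      = emeasure lborel ((P \<inter> {a..<b}) \<union> (P \<inter> {b..<c}))"
    using assms(1) by (intro plus_emeasure) auto
  also have "(P \<inter> {a..<b}) \<union> (P \<inter> {b..<c}) = P \<inter> {a..<c}"
    unfolding Int_Un_distrib[symmetric] ivl_disj_un_two(3)[OF assms(2,3)] by (rule refl)
  finally show ?thesis by (rule sym)
qed

text \<open>Cut \<open>{s..<s + p}\<close> at a multiple \<open>r + p\<close> of \<open>p\<close>:
  the part beyond it, moved back by one period, completes the rest to \<open>{r..<r + p}\<close>,
  and a multiple of \<open>p\<close> carries this to \<open>{0..<p}\<close>.\<close>

lemma emeasure_lborel_period:
  fixes P :: "real set"
  assumes P: "P \<in> sets borel" and per: "\<And>x. x + p \<in> P \<longleftrightarrow> x \<in> P" and p: "p > 0"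
  shows "emeasure lborel (P \<inter> {s..<s + p}) = emeasure lborel (P \<inter> {0..<p})"
proof -
  define k :: int where "k = \<lfloor>s / p\<rfloor>"
  define r where "r = of_int k * p"
  have "of_int k \<le> s / p" "s / p < of_int k + 1"
    unfolding k_def by linarith+
  then have r: "r \<le> s" "s \<le> r + p"
    using p by (simp_all add: r_def field_simps)
  have "emeasure lborel (P \<inter> {s..<s + p})
      = emeasure lborel (P \<inter> {s..<r + p}) + emeasure lborel (P \<inter> {r + p..<s + p})"
    using r by (intro emeasure_lborel_split P) auto
  also have "emeasure lborel (P \<inter> {r + p..<s + p}) = emeasure lborel (P \<inter> {r..<s})"
    by (rule emeasure_lborel_periodic_shift[OF P per])
  also have "emeasure lborel (P \<inter> {s..<r + p}) + \<dots> = \<dots> + emeasure lborel (P \<inter> {s..<r + p})"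
    by (rule add.commute)
  also have "\<dots> = emeasure lborel (P \<inter> {r..<r + p})"
    using r by (intro emeasure_lborel_split[symmetric] P) auto
  also have "\<dots> = emeasure lborel (P \<inter> {0..<p})"
    using emeasure_lborel_periodic_shift[OF P, of r 0 p] periodic_of_int[OF per, of _ k]
    unfolding r_def by (simp only: add_0 add.commute[of p])
  finally show ?thesis .
qed

lemma emeasure_lborel_periods:
  fixes P :: "real set"
  assumes P: "P \<in> sets borel" and per: "\<And>x. x + p \<in> P \<longleftrightarrow> x \<in> P" and p: "p > 0"
  shows "emeasure lborel (P \<inter> {s..<s + of_nat n * p}) = of_nat n * emeasure lborel (P \<inter> {0..<p})"
proof (induction n)
  case (Suc n)
  have "emeasure lborel (P \<inter> {s..<s + of_nat (Suc n) * p})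
      = emeasure lborel (P \<inter> {s..<s + of_nat n * p})
      + emeasure lborel (P \<inter> {s + of_nat n * p..<s + of_nat (Suc n) * p})"
    using p by (intro emeasure_lborel_split P) (auto simp: algebra_simps)
  also have "{s + of_nat n * p..<s + of_nat (Suc n) * p} = {s + of_nat n * p..<(s + of_nat n * p) + p}"
    by (simp add: algebra_simps)
  also have "emeasure lborel (P \<inter> \<dots>) = emeasure lborel (P \<inter> {0..<p})"
    by (rule emeasure_lborel_period[OF P per p])
  finally show ?case
    unfolding Suc.IH by (simp only: of_nat_Suc distrib_right mult_1_left add.commute)
qed simp

section \<open>The uniform law and affine maps modulo 1\<close>

lemma emeasure_unif01:
  assumes "A \<in> sets borel"
  shows "emeasure unif01 A = emeasure lborel (A \<inter> {0..<1})"
  using assms ennreal_mult_divide_eq[of 1 "emeasure lborel (A \<inter> {0..<1})"]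
  by (simp add: Int_commute)

lemma prob_space_unif01: "prob_space unif01"
  by (rule prob_space_uniform_measure) auto

lemma frac_add_1 [simp]: "frac (x + 1) = frac (x :: real)"
  by (simp add: frac_def)

lemma measurable_frac [measurable]: "frac \<in> borel_measurable (borel :: real measure)"
  unfolding frac_def[abs_def] by measurable

text \<open>Stretching by \<open>q\<close> carries [0, 1) onto \<open>q\<close> full periods of the
  1-periodic set \<open>P\<close> of points whose fractional part lies in \<open>A\<close>, so the
  factor \<open>q\<close> cancels. The case \<open>q = 1\<close> serves for stationarity, general
  \<open>q\<close> for the law of \<open>frac (q * u)\<close>.\<close>

lemma distr_unif01_affine_frac:
  assumes "q > 0"
  shows "distr unif01 borel (\<lambda>u. frac (of_nat q * u + s)) = unif01"
proof (rule measure_eqI)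
  fix A assume "A \<in> sets (distr unif01 borel (\<lambda>u. frac (of_nat q * u + s)))"
  then have A[measurable]: "A \<in> sets borel" by simp
  define P where "P = frac -` A"
  have P[measurable]: "P \<in> sets borel"
    unfolding P_def using measurable_sets_borel[OF measurable_frac A] by simp
  have per: "x + 1 \<in> P \<longleftrightarrow> x \<in> P" for x
    by (simp add: P_def)
  let ?D = "(\<lambda>u. frac (of_nat q * u + s)) -` A \<inter> {0..<1}"
  have D: "?D = (\<lambda>u. s + of_nat q * u) -` (P \<inter> {s..<s + of_nat q * 1})"
    using assms by (auto simp: P_def add.commute zero_le_mult_iff)
  have "emeasure lborel (P \<inter> {s..<s + of_nat q * 1})
      = emeasure (density (distr lborel borel (\<lambda>u. s + of_nat q * u)) (\<lambda>_. ennreal \<bar>of_nat q\<bar>))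
          (P \<inter> {s..<s + of_nat q * 1})"
    using assms by (subst lborel_real_affine[of "of_nat q" s]) auto
  also have "\<dots> = of_nat q * emeasure lborel ?D"
    unfolding D
    by (subst emeasure_density_const, simp, subst emeasure_distr) (auto simp: ennreal_of_nat_eq_real_of_nat)
  finally have "of_nat q * emeasure lborel ?D = of_nat q * emeasure lborel (P \<inter> {0..<1})"
    using emeasure_lborel_periods[OF P per, where s = s and n = q] by simp
  then have "emeasure lborel ?D = emeasure lborel (P \<inter> {0..<1})"
    using assms by (simp add: ennreal_mult_cancel_left)
  moreover have "P \<inter> {0..<1} = A \<inter> {0..<1}"
    by (auto simp: P_def frac_eq)
  ultimately have "emeasure lborel ?D = emeasure lborel (A \<inter> {0..<1})" by simp
  moreover have "(\<lambda>u. frac (of_nat q * u + s)) -` A \<in> sets borel"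
    using measurable_sets_borel[OF _ A, of "\<lambda>u. frac (of_nat q * u + s)"] by simp
  ultimately show "emeasure (distr unif01 borel (\<lambda>u. frac (of_nat q * u + s))) A = emeasure unif01 A"
    by (subst emeasure_distr) (auto simp: emeasure_unif01 A simp del: emeasure_uniform_measure)
qed simp

section \<open>Zero-one law for sets with arbitrarily small periods\<close>

text \<open>Up to an error of at most \<open>d\<close>, an interval holds as many periods of length
  \<open>d\<close> as its length suggests. Comparing \<open>{a..<b}\<close> with
  \<open>{0..<1}\<close> eliminates the measure of one period, and \<open>d\<close> can be
  arbitrarily small.\<close>

lemma measure_lborel_small_periods:
  fixes C :: "real set"
  assumes C: "C \<in> sets borel"
    and per: "\<And>e. e > 0 \<Longrightarrow> \<exists>d. 0 < d \<and> d < e \<and> (\<forall>x. x + d \<in> C \<longleftrightarrow> x \<in> C)"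
    and ab: "a \<le> b"
  shows "measure lborel (C \<inter> {a..<b}) = (b - a) * measure lborel (C \<inter> {0..<1})"
proof -
  let ?m = "\<lambda>s t. measure lborel (C \<inter> {s..<t})"
  have fin: "emeasure lborel (C \<inter> {s..<t}) \<noteq> \<infinity>" for s t
  proof -
    have "emeasure lborel (C \<inter> {s..<t}) \<le> emeasure lborel {s..t}"
      by (rule emeasure_mono) auto
    also have "\<dots> < \<infinity>" by (cases "s \<le> t") auto
    finally show ?thesis by simp
  qed
  have mono: "?m s t \<le> ?m s' t'" if "s' \<le> s" "t \<le> t'" for s t s' t'
    unfolding measure_def
    by (intro enn2real_mono emeasure_mono) (use that C fin in \<open>auto simp: less_top\<close>)
  \<comment> \<open>With \<open>k\<close> whole periods in \<open>{s..<t}\<close>, both compared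
    quantities lie between \<open>k\<close> and \<open>k + 1\<close> times the measure of one
    period, which is at most \<open>d\<close>.\<close>
  have approx: "\<bar>?m s t - (t - s) / d * ?m 0 d\<bar> \<le> d"
    if d: "0 < d" "\<And>x. x + d \<in> C \<longleftrightarrow> x \<in> C" and st: "s \<le> t" for s t d
  proof -
    have periods: "?m s (s + of_nat n * d) = of_nat n * ?m 0 d" for n
      using emeasure_lborel_periods[OF C d(2) d(1), of s n] by (simp add: measure_def enn2real_mult)
    define k where "k = nat \<lfloor>(t - s) / d\<rfloor>"
    have "(t - s) / d \<ge> 0" using d st by simp
    then have k: "of_nat k \<le> (t - s) / d" "(t - s) / d \<le> of_nat (Suc k)"
      unfolding k_def by linarith+
    have "of_nat k * ?m 0 d \<le> ?m s t"
      unfolding periods[symmetric] using k(1) d by (intro mono) (auto simp: field_simps)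
    moreover have "?m s t \<le> of_nat (Suc k) * ?m 0 d"
      unfolding periods[symmetric] using k(2) d by (intro mono) (auto simp: field_simps)
    moreover have "of_nat k * ?m 0 d \<le> (t - s) / d * ?m 0 d"
      by (intro mult_right_mono k) auto
    moreover have "(t - s) / d * ?m 0 d \<le> of_nat (Suc k) * ?m 0 d"
      by (intro mult_right_mono k) auto
    moreover have "?m 0 d \<le> measure lborel {0..<d}"
      using d(1) C by (intro measure_mono_fmeasurable) (auto simp: fmeasurable_def)
    ultimately show ?thesis
      using d(1) by (simp add: abs_le_iff algebra_simps)
  qed
  have "\<bar>?m a b - (b - a) * ?m 0 1\<bar> \<le> 0 + e" if e: "e > 0" for e
  proof -
    \<comment> \<open>The two errors are \<open>d\<close> for \<open>{a..<b}\<close> and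
      \<open>(b - a) * d\<close> for the scaled unit interval; their sum has to stay below
      \<open>e\<close>.\<close>
    have "e / (1 + (b - a)) > 0" using e ab by simp
    then obtain d where d: "0 < d" "d < e / (1 + (b - a))" "\<And>x. x + d \<in> C \<longleftrightarrow> x \<in> C"
      using per by blast
    have 1: "\<bar>?m a b - (b - a) / d * ?m 0 d\<bar> \<le> d"
      by (rule approx) (use d ab in auto)
    have "\<bar>?m 0 1 - (1 - 0) / d * ?m 0 d\<bar> \<le> d"
      by (rule approx) (use d ab in auto)
    then have "(b - a) * \<bar>?m 0 1 - (1 - 0) / d * ?m 0 d\<bar> \<le> (b - a) * d"
      using ab by (intro mult_left_mono) auto
    then have 2: "\<bar>(b - a) * ?m 0 1 - (b - a) / d * ?m 0 d\<bar> \<le> (b - a) * d"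
      using ab by (simp add: abs_mult_pos' right_diff_distrib)
    have "\<bar>?m a b - (b - a) * ?m 0 1\<bar> \<le> d * (1 + (b - a))"
    proof -
      have "d * (1 + (b - a)) = d + (b - a) * d" by (simp add: algebra_simps)
      then show ?thesis using 1 2 by linarith
    qed
    also have "\<dots> \<le> e"
      using d ab by (simp add: field_simps)
    finally show ?thesis by simp
  qed
  then have "\<bar>?m a b - (b - a) * ?m 0 1\<bar> \<le> 0"
    by (rule field_le_epsilon)
  then show ?thesis by simp
qed

text \<open>If the density \<open>c\<close> is positive, Lebesgue measure restricted to
  \<open>C\<close> and divided by \<open>c\<close> agrees with Lebesgue measure on intervals, hence
  everywhere. The restricted measure gives no mass to the complement of \<open>C\<close>, which is
  therefore null.\<close>

lemma zero_one_law_small_periods: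
  fixes C :: "real set"
  assumes C[measurable]: "C \<in> sets borel"
    and per: "\<And>e. e > 0 \<Longrightarrow> \<exists>d. 0 < d \<and> d < e \<and> (\<forall>x. x + d \<in> C \<longleftrightarrow> x \<in> C)"
  shows "emeasure lborel (C \<inter> {0..<1}) \<in> {0, 1}"
proof -
  have fin: "emeasure lborel (C \<inter> {s..<t}) = ennreal (measure lborel (C \<inter> {s..<t}))" for s t
  proof -
    have "emeasure lborel (C \<inter> {s..<t}) \<le> emeasure lborel {s..t}"
      by (rule emeasure_mono) auto
    also have "\<dots> < \<infinity>" by (cases "s \<le> t") auto
    finally show ?thesis by (intro emeasure_eq_ennreal_measure) simp
  qed
  define c where "c = measure lborel (C \<inter> {0..<1})"
  show ?thesis
  proof (cases "c = 0")
    case True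
    then show ?thesis using fin[of 0 1] by (simp add: c_def)
  next
    case False
    then have c: "c > 0" by (simp add: c_def less_le)
    have density: "lborel = density lborel (\<lambda>x. ennreal (1 / c) * indicator C x)"
    proof (rule lborel_eqI)
      fix l u :: real assume "\<And>b. b \<in> Basis \<Longrightarrow> l \<bullet> b \<le> u \<bullet> b"
      then have lu: "l \<le> u" by simp
      have "emeasure (density lborel (\<lambda>x. ennreal (1 / c) * indicator C x)) (box l u)
          = (\<integral>\<^sup>+x. ennreal (1 / c) * indicator (C \<inter> box l u) x \<partial>lborel)"
        by (subst emeasure_density) (auto intro!: nn_integral_cong split: split_indicator)
      also have "\<dots> = ennreal (1 / c) * emeasure lborel (C \<inter> box l u)"
        by (subst nn_integral_cmult) auto
      \<comment> \<open>The open and the half-open interval differ at most by the point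
        \<open>l\<close>.\<close>
      also have "emeasure lborel (C \<inter> box l u) = emeasure lborel (C \<inter> {l..<u})"
      proof (rule emeasure_eq_AE)
        show "AE x in lborel. (x \<in> C \<inter> box l u) = (x \<in> C \<inter> {l..<u})"
          using AE_lborel_singleton[of l] by eventually_elim (auto simp: box_real)
      qed auto
      also have "\<dots> = ennreal ((u - l) * c)"
        using fin measure_lborel_small_periods[OF C per lu] by (simp add: c_def)
      also have "ennreal (1 / c) * \<dots> = ennreal (u - l)"
        using c lu by (simp flip: ennreal_mult)
      finally show "emeasure (density lborel (\<lambda>x. ennreal (1 / c) * indicator C x)) (box l u)
          = (\<Prod>b\<in>Basis. (u - l) \<bullet> b)" by simp
    qed simp
    have "emeasure lborel (- C \<inter> {0..<1})
        = emeasure (density lborel (\<lambda>x. ennreal (1 / c) * indicator C x)) (- C \<inter> {0..<1})"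
      using density by simp
    also have "\<dots> = 0"
      by (subst emeasure_density) (auto split: split_indicator simp: nn_integral_0_iff_AE)
    finally have 0: "emeasure lborel (- C \<inter> {0..<1}) = 0" .
    have "emeasure lborel {0..<1::real} = emeasure lborel ((C \<inter> {0..<1}) \<union> (- C \<inter> {0..<1}))"
      by (rule arg_cong[where f = "emeasure lborel"]) auto
    also have "\<dots> = emeasure lborel (C \<inter> {0..<1}) + emeasure lborel (- C \<inter> {0..<1})"
      by (rule plus_emeasure[symmetric]) auto
    finally show ?thesis using 0 by simp
  qed
qed

section \<open>Partitions into the level sets of an index function\<close>

definition fibres :: "('a \<Rightarrow> 'b) \<Rightarrow> 'a set set" where
  "fibres g = range (\<lambda>x. {y. g y = g x})"

lemma partition_on_fibres: "partition_on UNIV (fibres g)"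
  by (auto simp: partition_on_def fibres_def disjoint_def)

lemma cell_fibres: "cell (fibres g) x = {y. g y = g x}"
  unfolding cell_def by (rule the_equality) (auto simp: fibres_def)

text \<open>The floor selects an interval of length \<open>1 / h\<close>, the bit separates the set
  \<open>E\<close> of the overview from its complement; a cell may thus consist of many short
  pieces.\<close>

definition cell_index :: "real \<Rightarrow> nat \<Rightarrow> real \<Rightarrow> int \<times> bool" where
  "cell_index h q x = (\<lfloor>h * x\<rfloor>, frac (of_nat q * x) < 1/2)"

lemma borel_partition_fibres:
  fixes g :: "real \<Rightarrow> 'b :: countable"
  assumes g: "g \<in> borel \<rightarrow>\<^sub>M count_space UNIV"
  shows "borel_partition (fibres g)"
proof -
  have "fibres g = (\<lambda>c. g -` {c}) ` range g"
    by (auto simp: fibres_def)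
  then have "countable (fibres g)" by simp
  moreover have "g -` {c} \<in> sets borel" for c
    using measurable_sets[OF g, of "{c}"] by simp
  then have "fibres g \<subseteq> sets borel"
    by (auto simp: fibres_def vimage_def)
  ultimately show ?thesis
    by (simp add: borel_partition_def partition_on_fibres)
qed

lemma measurable_cell_index: "cell_index h q \<in> borel \<rightarrow>\<^sub>M count_space UNIV"
proof -
  have "(\<lambda>x. (\<lfloor>h * x\<rfloor>, frac (of_nat q * x) < 1/2))
      \<in> borel \<rightarrow>\<^sub>M (count_space UNIV \<Otimes>\<^sub>M count_space UNIV :: (int \<times> bool) measure)"
    by measurable
  then show ?thesis
    by (simp add: cell_index_def[abs_def] pair_measure_countable)
qed

lemma ediam_cell:
  assumes "h > 0" "A \<in> fibres (cell_index h q)"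
  shows "ediam A \<le> ennreal (1 / h)"
  unfolding ediam_def
proof (intro SUP_least ennreal_leI)
  fix x y assume "x \<in> A" "y \<in> A"
  then have "\<lfloor>h * x\<rfloor> = \<lfloor>h * y\<rfloor>"
    using assms(2) by (auto simp: fibres_def cell_index_def)
  then have "\<bar>h * x - h * y\<bar> < 1" by linarith
  then have "h * \<bar>x - y\<bar> < 1"
    using assms(1) by (simp add: abs_mult_pos' right_diff_distrib)
  then show "\<bar>x - y\<bar> \<le> 1 / h"
    using assms(1) by (simp add: field_simps)
qed

text \<open>The index of a cell that meets \<open>S\<close> has its floor between those of
  \<open>- (h * \<bar>R\<bar>)\<close> and \<open>h * \<bar>R\<bar>\<close>, and each floor admits
  two bits. The absolute value covers a negative \<open>R\<close>, possible for empty
  \<open>S\<close>.\<close>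

lemma cells_meeting_bounded:
  assumes h: "h > 0" and S: "\<And>x. x \<in> S \<Longrightarrow> \<bar>x\<bar> \<le> R"
  shows "finite (cells_meeting (fibres (cell_index h q)) S)" (is "finite ?Q")
    and "real (card (cells_meeting (fibres (cell_index h q)) S)) \<le> 4 * (h * \<bar>R\<bar> + 1)"
proof -
  let ?g = "cell_index h q"
  define J where "J = {\<lfloor>- (h * \<bar>R\<bar>)\<rfloor>..\<lfloor>h * \<bar>R\<bar>\<rfloor>}"
  have sub: "?Q \<subseteq> (\<lambda>c. ?g -` {c}) ` (J \<times> UNIV)"
  proof
    fix A assume "A \<in> ?Q"
    then obtain x where x: "x \<in> S" "A = ?g -` {?g x}"
      by (force simp: cells_meeting_def fibres_def)
    have "\<bar>x\<bar> \<le> \<bar>R\<bar>"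
      using S[OF x(1)] by linarith
    then have "h * \<bar>x\<bar> \<le> h * \<bar>R\<bar>"
      using h by (intro mult_left_mono) auto
    moreover have "h * \<bar>x\<bar> = \<bar>h * x\<bar>"
      using h by (simp add: abs_mult)
    ultimately have "- (h * \<bar>R\<bar>) \<le> h * x" "h * x \<le> h * \<bar>R\<bar>"
      by linarith+
    then have "?g x \<in> J \<times> UNIV"
      by (simp add: cell_index_def J_def floor_mono)
    then show "A \<in> (\<lambda>c. ?g -` {c}) ` (J \<times> UNIV)"
      unfolding x(2) by (rule imageI)
  qed
  have fin: "finite (J \<times> (UNIV :: bool set))" by (simp add: J_def)
  show "finite ?Q" using sub fin by (rule finite_surj[rotated])
  have "card ?Q \<le> card (J \<times> (UNIV :: bool set))"
    using surj_card_le[OF fin sub] .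
  also have "\<dots> = 2 * nat (\<lfloor>h * \<bar>R\<bar>\<rfloor> - \<lfloor>- (h * \<bar>R\<bar>)\<rfloor> + 1)"
    by (simp add: J_def card_cartesian_product)
  finally have "real (card ?Q) \<le> 2 * real (nat (\<lfloor>h * \<bar>R\<bar>\<rfloor> - \<lfloor>- (h * \<bar>R\<bar>)\<rfloor> + 1))"
    by linarith
  also have "\<dots> \<le> 4 * (h * \<bar>R\<bar> + 1)"
  proof -
    have "h * \<bar>R\<bar> \<ge> 0" using h by simp
    then have "\<lfloor>h * \<bar>R\<bar>\<rfloor> - \<lfloor>- (h * \<bar>R\<bar>)\<rfloor> + 1 \<ge> 0" by linarith
    \<comment> \<open>The floor of \<open>y\<close> is at most \<open>y\<close>, and minus the floor
      of \<open>- y\<close> is less than \<open>y + 1\<close>. The two bits then double the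
      bound.\<close>
    moreover have "of_int (\<lfloor>y\<rfloor> - \<lfloor>- y\<rfloor> + 1) \<le> 2 * (y + 1)" for y :: real
      using floor_correct[of y] floor_correct[of "- y"]
      by (simp only: of_int_add of_int_diff of_int_1) argo
    from this[of "h * \<bar>R\<bar>"]
    have "of_int (\<lfloor>h * \<bar>R\<bar>\<rfloor> - \<lfloor>- (h * \<bar>R\<bar>)\<rfloor> + 1) \<le> 2 * (h * \<bar>R\<bar> + 1)" .
    ultimately show ?thesis by simp
  qed
  finally show "real (card ?Q) \<le> 4 * (h * \<bar>R\<bar> + 1)" .
qed

text \<open>With \<open>h = sqrt n\<close> the mesh \<open>1 / sqrt n\<close> vanishes, while the
  number of cells meeting \<open>S\<close> is of order \<open>sqrt n\<close> only. Neither bound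
  involves \<open>q\<close>, so \<open>q n\<close> may be as large as Dirichlet's theorem
  demands.\<close>

lemma shrinking_partitions_fibres:
  "shrinking_partitions (\<lambda>n. fibres (cell_index (sqrt (real n)) (q n)))"
  unfolding shrinking_partitions_def
proof (intro allI impI conjI)
  fix S :: "real set"
  let ?Q = "\<lambda>n. fibres (cell_index (sqrt (real n)) (q n))"
  assume "symmetric_bounded_interval S"
  then obtain R where R: "\<And>x. x \<in> S \<Longrightarrow> \<bar>x\<bar> \<le> R"
    by (auto simp: symmetric_bounded_interval_def bounded_iff)
  show "(\<lambda>n. SUP A\<in>cells_meeting (?Q n) S. ediam A) \<longlonglongrightarrow> 0"
  proof (rule tendsto_sandwich[OF _ _ tendsto_const])
    show "\<forall>\<^sub>F n in sequentially. (SUP A\<in>cells_meeting (?Q n) S. ediam A) \<le> ennreal (1 / sqrt (real n))"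
      using eventually_gt_at_top[of 0]
      by eventually_elim (auto intro!: SUP_least ediam_cell simp: cells_meeting_def)
    have "(\<lambda>n. 1 / sqrt (real n)) \<longlonglongrightarrow> 0" by real_asymp
    then show "(\<lambda>n. ennreal (1 / sqrt (real n))) \<longlonglongrightarrow> 0"
      using tendsto_ennrealI by fastforce
  qed auto
  show "\<forall>\<^sub>F n in sequentially. finite (cells_meeting (?Q n) S)"
    using eventually_gt_at_top[of 0] by eventually_elim (intro cells_meeting_bounded(1)[OF _ R], auto)
  show "(\<lambda>n. real (card (cells_meeting (?Q n) S)) / real n) \<longlonglongrightarrow> 0"
  proof (rule tendsto_sandwich[OF _ _ tendsto_const])
    show "\<forall>\<^sub>F n in sequentially. real (card (cells_meeting (?Q n) S)) / real n
        \<le> 4 * (sqrt (real n) * \<bar>R\<bar> + 1) / real n"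
      using eventually_gt_at_top[of 0]
      by eventually_elim (intro divide_right_mono cells_meeting_bounded(2)[OF _ R], auto)
    show "(\<lambda>n. 4 * (sqrt (real n) * \<bar>R\<bar> + 1) / real n) \<longlonglongrightarrow> 0"
      by real_asymp
  qed auto
qed

section \<open>The irrational rotation: stationarity, ergodicity, regression function\<close>

text \<open>
  Only coordinate \<open>0\<close> of the sample point is used: it carries the initial phase, uniform on \<open>[0, 1)\<close>.
\<close>

definition rotation :: "real \<Rightarrow> int \<Rightarrow> (int \<Rightarrow> real) \<Rightarrow> real" where
  "rotation \<alpha> i \<omega> = frac (\<omega> 0 + of_int i * \<alpha>)"

text \<open>Copying the uniform phase into every coordinate gives a probability measure on the
  sample space of paths that the theorem asks for.\<close>

abbreviation constant_paths :: "(int \<Rightarrow> real) measure" where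
  "constant_paths \<equiv> distr unif01 path_space (\<lambda>u i. u)"

lemma measurable_path_space:
  assumes f: "\<And>i. f i \<in> borel_measurable N"
  shows "(\<lambda>\<omega> i. f i \<omega>) \<in> N \<rightarrow>\<^sub>M path_space"
proof (rule measurable_PiM_single'[of UNIV f])
  show "(\<lambda>\<omega> i. f i \<omega>) \<in> space N \<rightarrow> (\<Pi>\<^sub>E i\<in>UNIV. space borel)"
    by (simp add: Pi_def)
qed (rule f)

lemma measurable_constant_path: "(\<lambda>u i. u) \<in> borel \<rightarrow>\<^sub>M path_space"
  by (rule measurable_path_space) simp

lemma prob_space_constant_paths: "prob_space constant_paths"
  using measurable_constant_path
  by (intro prob_space.prob_space_distr prob_space_unif01) (simp cong: measurable_cong_sets)

lemma measurable_rotation [measurable]: "rotation \<alpha> i \<in> borel_measurable path_space"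
  unfolding rotation_def[abs_def] by measurable

lemma measurable_rotation_path [measurable]:
  "(\<lambda>u i. frac (u + of_int i * \<alpha>)) \<in> borel \<rightarrow>\<^sub>M path_space"
  by (rule measurable_path_space) measurable

lemma distr_constant_paths:
  assumes "f \<in> path_space \<rightarrow>\<^sub>M N"
  shows "distr constant_paths N f = distr unif01 N (\<lambda>u. f (\<lambda>i. u))"
  using assms measurable_constant_path
  by (subst distr_distr) (auto simp: comp_def cong: measurable_cong_sets)

lemma prob_constant_paths:
  assumes "Measurable.pred path_space P"
  shows "\<P>(\<omega> in constant_paths. P \<omega>) = measure unif01 {u. P (\<lambda>i. u)}"
proof -
  have "{\<omega>. P \<omega>} \<in> sets path_space"
    using assms by (simp add: pred_def space_PiM)
  then show ?thesis
    using measurable_constant_path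
    by (subst measure_distr) (auto simp: space_PiM vimage_def cong: measurable_cong_sets)
qed

lemma measure_unif01_affine_frac:
  assumes "q > 0" and A: "A \<in> sets borel"
  shows "measure unif01 {u. frac (of_nat q * u + s) \<in> A} = measure lborel (A \<inter> {0..<1})"
proof -
  have "measure unif01 {u. frac (of_nat q * u + s) \<in> A}
      = measure (distr unif01 borel (\<lambda>u. frac (of_nat q * u + s))) A"
    using A by (subst measure_distr) (auto simp: vimage_def)
  also have "\<dots> = measure lborel (A \<inter> {0..<1})"
    unfolding distr_unif01_affine_frac[OF assms(1)] by (simp add: measure_def emeasure_unif01[OF A])
  finally show ?thesis .
qed

lemma distr_rotation: "distr constant_paths borel (rotation \<alpha> i) = unif01"
  using distr_unif01_affine_frac[of 1 "of_int i * \<alpha>"]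
  by (subst distr_constant_paths) (auto simp: rotation_def)

lemma real_process_rotation: "real_process constant_paths (rotation \<alpha>)"
  by (simp add: real_process_def prob_space_constant_paths)

lemma frac_frac_add: "frac (frac x + y) = frac (x + y :: real)"
proof -
  have "frac x + y = (x + y) - of_int \<lfloor>x\<rfloor>"
    by (simp add: frac_def)
  then show ?thesis
    by (simp only:) (simp add: frac_def[of "x + y - _"] frac_def[of "x + y"] floor_diff_of_int)
qed

text \<open>A time shift by \<open>k\<close> amounts to the starting phase
  \<open>frac (u + k * \<alpha>)\<close>, which is again uniform. The right side is free of
  \<open>k\<close>, and this is stationarity.\<close>

lemma distr_rotation_shift:
  "distr constant_paths path_space (\<lambda>\<omega> i. rotation \<alpha> (i + k) \<omega>)
     = distr unif01 path_space (\<lambda>u i. frac (u + of_int i * \<alpha>))"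
proof -
  \<comment> \<open>The factor \<open>of_nat 1\<close> gives the rotation the form of
    \<open>distr_unif01_affine_frac\<close> with \<open>q = 1\<close>.\<close>
  let ?T = "\<lambda>u. frac (of_nat 1 * u + of_int k * \<alpha>)"
  let ?path = "\<lambda>u i. frac (u + of_int i * \<alpha>) :: real"
  have "distr constant_paths path_space (\<lambda>\<omega> i. rotation \<alpha> (i + k) \<omega>)
      = distr unif01 path_space (\<lambda>u i. rotation \<alpha> (i + k) (\<lambda>i. u))"
    by (intro distr_constant_paths measurable_path_space measurable_rotation)
  also have "(\<lambda>u i. rotation \<alpha> (i + k) (\<lambda>i. u)) = ?path \<circ> ?T"
    by (simp add: rotation_def frac_frac_add fun_eq_iff algebra_simps)
  also have "distr unif01 path_space (?path \<circ> ?T) = distr (distr unif01 borel ?T) path_space ?path"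
    using measurable_rotation_path
    by (intro distr_distr[symmetric]) (simp_all cong: measurable_cong_sets)
  also have "\<dots> = distr unif01 path_space ?path"
    by (subst distr_unif01_affine_frac) auto
  finally show ?thesis .
qed

lemma stationary_rotation: "stationary_process constant_paths (rotation \<alpha>)"
  unfolding stationary_process_def
  using distr_rotation_shift[of \<alpha>] distr_rotation_shift[of \<alpha> 0] by simp

text \<open>Dirichlet's theorem provides an integer combination of \<open>\<alpha>\<close> and 1 of
  absolute value below \<open>e\<close>. It inherits being a period, and irrationality keeps it from
  being 0.\<close>

lemma irrational_small_periods:
  fixes C :: "real set"
  assumes \<alpha>: "\<alpha> \<notin> \<rat>" and e: "e > 0"
    and per: "\<And>x. x + \<alpha> \<in> C \<longleftrightarrow> x \<in> C" "\<And>x. x + 1 \<in> C \<longleftrightarrow> x \<in> C"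
  shows "\<exists>d. 0 < d \<and> d < e \<and> (\<forall>x. x + d \<in> C \<longleftrightarrow> x \<in> C)"
proof -
  obtain N where N: "N > 0" "1 / real N < e"
    using e by (metis nat_approx_posE of_nat_Suc zero_less_Suc)
  obtain h k where k: "0 < k" "\<bar>of_int k * \<alpha> - of_int h\<bar> < 1 / real N"
    using Dirichlet_approx[OF N(1), of \<alpha>] by metis
  define d where "d = of_int k * \<alpha> - of_int h"
  have "d \<noteq> 0"
  proof
    assume "d = 0"
    then have "\<alpha> = of_int h / of_int k" using k(1) by (simp add: d_def field_simps)
    then show False using \<alpha> by simp
  qed
  have *: "x + d \<in> C \<longleftrightarrow> x \<in> C" for x
  proof -
    have "x + of_int k * \<alpha> + of_int (- h) * 1 \<in> C \<longleftrightarrow> x \<in> C"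
      by (simp only: periodic_of_int[of 1 C, OF per(2)] periodic_of_int[of \<alpha> C, OF per(1)])
    then show ?thesis by (simp add: d_def algebra_simps)
  qed
  show ?thesis
  proof (cases "d > 0")
    case True
    then show ?thesis using * k(2) N(2) by (intro exI[of _ d]) (auto simp: d_def)
  next
    case False
    have "x + - d \<in> C \<longleftrightarrow> x \<in> C" for x
      using *[of "x + - d"] by simp
    then show ?thesis
      using False \<open>d \<noteq> 0\<close> k(2) N(2) by (intro exI[of _ "- d"]) (auto simp: d_def)
  qed
qed

lemma ergodic_rotation:
  assumes \<alpha>: "\<alpha> \<notin> \<rat>"
  shows "ergodic_process constant_paths (rotation \<alpha>)"
  unfolding ergodic_process_def
proof (intro ballI impI)
  fix B assume B[measurable]: "B \<in> sets path_space" and inv: "(\<lambda>z i. z (i + 1)) -` B = B"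
  \<comment> \<open>The orbit map is taken on the whole line so that \<open>C\<close> is exactly
    periodic: \<open>frac\<close> yields the period 1, invariance of \<open>B\<close> the period
    \<open>\<alpha>\<close>.\<close>
  define path where "path = (\<lambda>u i. frac (u + of_int i * \<alpha>) :: real)"
  have path: "path \<in> borel \<rightarrow>\<^sub>M path_space"
    unfolding path_def by (rule measurable_rotation_path)
  define C where "C = path -` B"
  have C: "C \<in> sets borel"
    using measurable_sets[OF path B] by (simp add: C_def)
  have "path (x + 1) = path x" for x
  proof
    fix i show "path (x + 1) i = path x i"
      using frac_add_1[of "x + of_int i * \<alpha>"] by (simp add: path_def algebra_simps)
  qed
  then have per1: "x + 1 \<in> C \<longleftrightarrow> x \<in> C" for x
    by (simp add: C_def)
  have per\<alpha>: "x + \<alpha> \<in> C \<longleftrightarrow> x \<in> C" for x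
  proof -
    have "path (x + \<alpha>) = (\<lambda>i. path x (i + 1))"
      by (simp add: path_def algebra_simps)
    moreover have "(\<lambda>i. path x (i + 1)) \<in> B \<longleftrightarrow> path x \<in> B"
      using inv by blast
    ultimately show ?thesis by (simp add: C_def)
  qed
  have 01: "emeasure lborel (C \<inter> {0..<1}) \<in> {0, 1}"
    by (rule zero_one_law_small_periods[OF C]) (rule irrational_small_periods[OF \<alpha> _ per\<alpha> per1])
  have [measurable]: "(\<lambda>\<omega> i. rotation \<alpha> i \<omega>) \<in> path_space \<rightarrow>\<^sub>M path_space"
    by (rule measurable_path_space) measurable
  have "\<P>(\<omega> in constant_paths. (\<lambda>i. rotation \<alpha> i \<omega>) \<in> B) = measure unif01 C"
    by (subst prob_constant_paths) (auto simp: rotation_def C_def path_def vimage_def)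
  also have "\<dots> = enn2real (emeasure lborel (C \<inter> {0..<1}))"
    by (simp add: measure_def emeasure_unif01[OF C])
  finally show "\<P>(\<omega> in constant_paths. (\<lambda>i. rotation \<alpha> i \<omega>) \<in> B) \<in> {0, 1}"
    using 01 by auto
qed

text \<open>The present is a function of the previous value, hence measurable for the sigma-algebra
  generated by it, and conditioning leaves it unchanged.\<close>

lemma autoregression_rotation:
  "autoregression_function constant_paths (rotation \<alpha>) (\<lambda>x. frac (x + \<alpha>))"
  unfolding autoregression_function_def
proof
  interpret prob_space constant_paths by (rule prob_space_constant_paths)
  let ?F = "vimage_algebra (space constant_paths) (rotation \<alpha> (- 1)) borel"
  interpret finite_measure_subalgebra constant_paths ?F
  proof
    show "subalgebra constant_paths ?F"
      using measurable_sets[OF measurable_rotation[of \<alpha> "- 1"]]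
      by (auto simp: subalgebra_def sets_vimage_algebra2 space_PiM)
  qed
  have eq: "rotation \<alpha> 0 \<omega> = frac (rotation \<alpha> (- 1) \<omega> + \<alpha>)" for \<omega>
    by (simp add: rotation_def frac_frac_add)
  have [measurable]: "rotation \<alpha> (- 1) \<in> borel_measurable ?F"
    by (rule measurable_vimage_algebra1) auto
  have "rotation \<alpha> 0 \<in> borel_measurable ?F"
    unfolding eq[abs_def] by measurable
  moreover have "integrable constant_paths (rotation \<alpha> 0)"
    by (rule integrable_const_bound[where B = 1]) (auto simp: rotation_def frac_lt_1 less_imp_le)
  ultimately have "AE \<omega> in constant_paths.
      real_cond_exp constant_paths ?F (rotation \<alpha> 0) \<omega> = rotation \<alpha> 0 \<omega>"
    by (intro real_cond_exp_F_meas)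
  then show "AE \<omega> in constant_paths.
      real_cond_exp constant_paths ?F (rotation \<alpha> 0) \<omega> = frac (rotation \<alpha> (- 1) \<omega> + \<alpha>)"
    by (simp add: eq)
qed measurable

section \<open>The estimate on the rotation and its error\<close>

lemma partitioning_estimate_bounds:
  assumes "\<And>i. 0 \<le> z i" "\<And>i. z i \<le> 1"
  shows "partitioning_estimate Q n z x \<in> {0..1}"
proof -
  let ?I = "\<lambda>i. indicator (cell Q x) (z (- 1 - int i)) :: real"
  have "0 \<le> (\<Sum>i=1..n-1. ?I i * z (- int i))"
    by (intro sum_nonneg) (auto simp: assms)
  moreover have "(\<Sum>i=1..n-1. ?I i * z (- int i)) \<le> (\<Sum>i=1..n-1. ?I i)"
    by (intro sum_mono) (auto simp: assms split: split_indicator)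
  ultimately show ?thesis
    by (auto simp: partitioning_estimate_def divide_le_eq_1 intro: divide_nonneg_nonneg)
qed

text \<open>The error is integrated over \<open>x\<close> and must then be measurable in the sample,
  so sample and evaluation point vary together. Written with floors and bits, the cell indicator is
  visibly measurable in both.\<close>

lemma measurable_partitioning_estimate [measurable]:
  assumes [measurable]: "\<And>i. (\<lambda>\<omega>. z \<omega> i) \<in> borel_measurable N" "f \<in> borel_measurable N"
  shows "(\<lambda>\<omega>. partitioning_estimate (fibres (cell_index h q)) n (z \<omega>) (f \<omega>)) \<in> borel_measurable N"
proof -
  have ind: "indicator (cell (fibres (cell_index h q)) x) y
      = (if \<lfloor>h * y\<rfloor> = \<lfloor>h * x\<rfloor> \<and> (frac (of_nat q * y) < 1/2 \<longleftrightarrow> frac (of_nat q * x) < 1/2)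
         then 1 else 0 :: real)" for x y
    by (simp add: cell_fibres cell_index_def)
  show ?thesis
    unfolding partitioning_estimate_def ind by measurable
qed

text \<open>
  Modulo 1, \<open>q X\<^sub>-\<^sub>j\<close> moves away from \<open>q u\<close> by \<open>j |q \<alpha> - p| \<le> 1/8\<close> only, so it stays in \<open>[1/2, 1)\<close>
  throughout the sample when it starts in \<open>(5/8, 7/8)\<close>.
\<close>

lemma partitioning_estimate_no_data:
  assumes q\<alpha>: "\<bar>of_nat q * \<alpha> - of_int p\<bar> * of_nat n \<le> 1/8"
    and u: "frac (of_nat q * u) \<in> {5/8<..<7/8}"
    and x: "frac (of_nat q * x) < 1/2"
  shows "partitioning_estimate (fibres (cell_index h q)) n (\<lambda>i. rotation \<alpha> i (\<lambda>_. u)) x = 0"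
proof -
  define \<delta> where "\<delta> = of_nat q * \<alpha> - of_int p"
  have "\<not> frac (of_nat q * rotation \<alpha> (- 1 - int i) (\<lambda>_. u)) < 1/2" if i: "i \<in> {1..n-1}" for i
  proof -
    \<comment> \<open>The indicators look at times \<open>- j\<close> with
      \<open>2 \<le> j \<le> n\<close>, so the drift \<open>j * \<delta>\<close> never exceeds
      \<open>n * \<bar>\<delta>\<bar>\<close>.\<close>
    define j where "j = 1 + int i"
    have "\<bar>of_int j * \<delta>\<bar> \<le> of_nat n * \<bar>\<delta>\<bar>"
      unfolding abs_mult using i by (intro mult_right_mono) (auto simp: j_def)
    then have d: "\<bar>of_int j * \<delta>\<bar> \<le> 1/8"
      using q\<alpha> by (simp add: \<delta>_def mult.commute)
    define y where "y = u + of_int (- j) * \<alpha>"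
    \<comment> \<open>As \<open>q\<close> is an integer, passing from \<open>y\<close> to
      \<open>frac y\<close> changes \<open>q * y\<close> by an integer only; so does replacing
      \<open>j * q * \<alpha>\<close> by \<open>j * \<delta>\<close>.\<close>
    have "of_nat q * frac y - (frac (of_nat q * u) - of_int j * \<delta>)
        = of_int (\<lfloor>of_nat q * u\<rfloor> - j * p - int q * \<lfloor>y\<rfloor>)"
      by (simp add: frac_def y_def \<delta>_def algebra_simps)
    then have "of_nat q * frac y - (frac (of_nat q * u) - of_int j * \<delta>) \<in> \<int>"
      by (metis Ints_of_int)
    \<comment> \<open>No wrap-around: the right side lies in (1/2, 1), so congruence modulo 1 makes
      it the fractional part.\<close>
    then have "frac (of_nat q * frac y) = frac (of_nat q * u) - of_int j * \<delta>"
      using d u by (subst frac_unique_iff) auto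
    moreover have "- 1 - int i = - j" by (simp add: j_def)
    then have "rotation \<alpha> (- 1 - int i) (\<lambda>_. u) = frac y"
      by (simp only: rotation_def y_def)
    ultimately show ?thesis using d u by auto
  qed
  \<comment> \<open>The sampled points have bit \<open>False\<close> and \<open>x\<close> has bit
    \<open>True\<close>. All indicators vanish, and the estimate is
    \<open>0 / 0 = 0\<close>.\<close>
  then have "indicator (cell (fibres (cell_index h q)) x) (rotation \<alpha> (- 1 - int i) (\<lambda>_. u)) = (0::real)"
    if "i \<in> {1..n-1}" for i
    using that x by (simp add: cell_fibres cell_index_def)
  then show ?thesis by (simp add: partitioning_estimate_def)
qed

text \<open>
  The estimate vanishes on a set of measure \<open>1/2\<close>, while \<open>m < 1/4\<close> on a set of measure \<open>1/4\<close> only;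
  hence the constant \<open>1/4 * (1/2 - 1/4)\<close>.
\<close>

lemma integral_error_ge:
  assumes q: "q > 0" and est: "\<And>x. frac (of_nat q * x) < 1/2 \<Longrightarrow> r x = 0"
    and [measurable]: "r \<in> borel_measurable borel" and r: "\<And>x. r x \<in> {0..1}"
  shows "(LINT x|unif01. \<bar>r x - frac (x + \<alpha>)\<bar>) \<ge> 1/16"
proof -
  interpret prob_space unif01 by (rule prob_space_unif01)
  define E where "E = {x::real. frac (of_nat q * x + 0) \<in> {..<1/2}}"
  define G where "G = {x::real. frac (of_nat 1 * x + \<alpha>) \<in> {..<1/4}}"
  have [measurable]: "E \<in> sets borel" "G \<in> sets borel"
    unfolding E_def G_def by measurable
  have "measure unif01 E = measure lborel ({..<1/2} \<inter> {0..<1::real})"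
    unfolding E_def using q by (intro measure_unif01_affine_frac) auto
  also have "{..<1/2} \<inter> {0..<1::real} = {0..<1/2}" by auto
  finally have E: "measure unif01 E = 1/2" by simp
  have "measure unif01 G = measure lborel ({..<1/4} \<inter> {0..<1::real})"
    unfolding G_def by (intro measure_unif01_affine_frac) auto
  also have "{..<1/4} \<inter> {0..<1::real} = {0..<1/4}" by auto
  finally have G: "measure unif01 G = 1/4" by simp
  have int: "integrable unif01 (indicator E :: real \<Rightarrow> real)" "integrable unif01 (indicator G :: real \<Rightarrow> real)"
    by (intro integrable_real_indicator;
        simp add: emeasure_eq_measure del: emeasure_uniform_measure)+
  have "(1/16 :: real) = 1/4 * (measure unif01 E - measure unif01 G)"
    unfolding E G by simp
  also have "\<dots> = (LINT x|unif01. 1/4 * (indicator E x - indicator G x))"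
    using int by (simp del: measure_uniform_measure)
  also have "\<dots> \<le> (LINT x|unif01. \<bar>r x - frac (x + \<alpha>)\<bar>)"
  proof (rule integral_mono)
    show "integrable unif01 (\<lambda>x. 1/4 * (indicator E x - indicator G x) :: real)"
      using int by simp
    show "integrable unif01 (\<lambda>x. \<bar>r x - frac (x + \<alpha>)\<bar>)"
    proof (rule integrable_const_bound[where B = 1])
      have "norm \<bar>r x - frac (x + \<alpha>)\<bar> \<le> 1" for x
        using r[of x] frac_lt_1[of "x + \<alpha>"] frac_ge_0[of "x + \<alpha>"]
        unfolding atLeastAtMost_iff real_norm_def by linarith
      then show "AE x in unif01. norm \<bar>r x - frac (x + \<alpha>)\<bar> \<le> 1" by simp
    qed measurable
    \<comment> \<open>On \<open>E\<close> outside \<open>G\<close> the estimate is 0 and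
      \<open>m\<close> is at least 1/4; elsewhere the left side is at most 0, whatever the overlap
      of \<open>E\<close> and \<open>G\<close>.\<close>
    show "1/4 * (indicator E x - indicator G x) \<le> \<bar>r x - frac (x + \<alpha>)\<bar>" for x
    proof (cases "x \<in> E \<and> x \<notin> G")
      case True
      then show ?thesis using est[of x] by (auto simp: E_def G_def)
    next
      case False
      then have "1/4 * (indicator E x - indicator G x) \<le> (0 :: real)"
        by (auto split: split_indicator)
      then show ?thesis by (rule order_trans) simp
    qed
  qed
  finally show ?thesis .
qed

text \<open>Each phase \<open>u\<close> with \<open>frac (q * u)\<close> in (5/8, 7/8) makes the
  estimate vanish on \<open>E\<close>, so its error is at least 1/16. As \<open>frac (q * u)\<close>
  is uniform, such phases have probability 1/4.\<close>

lemma rotation_error: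
  assumes q: "q > 0" and q\<alpha>: "\<bar>of_nat q * \<alpha> - of_int p\<bar> * of_nat n \<le> 1/8"
  shows "\<P>(\<omega> in constant_paths.
      (LINT x|unif01. \<bar>partitioning_estimate (fibres (cell_index h q)) n (\<lambda>i. rotation \<alpha> i \<omega>) x
         - frac (x + \<alpha>)\<bar>) \<ge> 1/16) \<ge> 1/8"
proof -
  interpret prob_space unif01 by (rule prob_space_unif01)
  let ?err = "\<lambda>\<omega>. LINT x|unif01. \<bar>partitioning_estimate (fibres (cell_index h q)) n (\<lambda>i. rotation \<alpha> i \<omega>) x
         - frac (x + \<alpha>)\<bar>"
  have err[measurable]: "?err \<in> borel_measurable path_space"
    by measurable
  have "1/8 \<le> measure lborel ({5/8<..<7/8} \<inter> {0..<1::real})"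
  proof -
    have "{5/8<..<7/8} \<inter> {0..<1::real} = {5/8<..<7/8}" by auto
    then show ?thesis by simp
  qed
  also have "\<dots> = measure unif01 {u. frac (of_nat q * u + 0) \<in> {5/8<..<7/8}}"
    using q by (intro measure_unif01_affine_frac[symmetric]) auto
  also have "\<dots> \<le> measure unif01 {u. ?err (\<lambda>i. u) \<ge> 1/16}"
  proof (rule finite_measure_mono)
    show "{u. frac (of_nat q * u + 0) \<in> {5/8<..<7/8}} \<subseteq> {u. ?err (\<lambda>i. u) \<ge> 1/16}"
    proof safe
      fix u :: real assume u: "frac (of_nat q * u + 0) \<in> {5/8<..<7/8}"
      show "?err (\<lambda>i. u) \<ge> 1/16"
      proof (rule integral_error_ge[OF q])
        show "partitioning_estimate (fibres (cell_index h q)) n (\<lambda>i. rotation \<alpha> i (\<lambda>i. u)) x = 0"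
          if "frac (of_nat q * x) < 1/2" for x
          using partitioning_estimate_no_data[OF q\<alpha> _ that, of u] u by simp
        show "partitioning_estimate (fibres (cell_index h q)) n (\<lambda>i. rotation \<alpha> i (\<lambda>i. u)) x \<in> {0..1}" for x
          by (rule partitioning_estimate_bounds) (auto simp: rotation_def frac_lt_1 less_imp_le)
      qed measurable
    qed
    show "{u. ?err (\<lambda>i. u) \<ge> 1/16} \<in> sets unif01"
      using measurable_sets[OF measurable_compose[OF measurable_constant_path err], of "{1/16..}"]
      by (simp add: vimage_def)
  qed
  also have "\<dots> = \<P>(\<omega> in constant_paths. ?err \<omega> \<ge> 1/16)"
    by (subst prob_constant_paths) auto
  finally show ?thesis .
qed

section \<open>Choice of the angle and of the denominators \<open>q n\<close>\<close>

theorem theorem4: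
  "\<exists>(M :: (int \<Rightarrow> real) measure) (X :: int \<Rightarrow> (int \<Rightarrow> real) \<Rightarrow> real)
     (\<Q> :: nat \<Rightarrow> real set set) (m :: real \<Rightarrow> real).
     real_process M X \<and> stationary_process M X \<and> ergodic_process M X \<and>
     (\<forall>i. distr M borel (X i) = unif01) \<and>
     (\<forall>n. borel_partition (\<Q> n)) \<and> shrinking_partitions \<Q> \<and>
     autoregression_function M X m \<and>
     (\<forall>\<^sub>F n in sequentially.
        \<P>(\<omega> in M.
           (LINT x|unif01. \<bar>partitioning_estimate (\<Q> n) n (\<lambda>i. X i \<omega>) x - m x\<bar>) \<ge> 1/16)
        \<ge> 1/8)"
proof -
  have "\<rat> \<noteq> (UNIV :: real set)"
    using countable_rat uncountable_UNIV_real by metis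
  then obtain \<alpha> :: real where \<alpha>: "\<alpha> \<notin> \<rat>" by blast
  have "\<exists>q > 0. \<exists>p. \<bar>of_nat q * \<alpha> - of_int p\<bar> * of_nat n \<le> 1/8" for n :: nat
  proof -
    \<comment> \<open>Dirichlet's theorem asks for a positive bound, which \<open>8 * n + 1\<close>
      is even for \<open>n = 0\<close>; and \<open>n / (8 * n + 1)\<close> is at most 1/8.\<close>
    obtain p k where k: "0 < k" "\<bar>of_int k * \<alpha> - of_int p\<bar> < 1 / real (8 * n + 1)"
      using Dirichlet_approx[of "8 * n + 1" \<alpha>] by (metis add_gr_0 zero_less_one)
    have "\<bar>of_int k * \<alpha> - of_int p\<bar> * of_nat n \<le> 1 / real (8 * n + 1) * of_nat n"
      using k(2) by (intro mult_right_mono) auto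
    also have "\<dots> \<le> 1/8" by (simp add: field_simps)
    finally show ?thesis
      using k(1) by (intro exI[of _ "nat k"]) auto
  qed
  then obtain q where q: "\<And>n. q n > 0" "\<And>n. \<exists>p. \<bar>of_nat (q n) * \<alpha> - of_int p\<bar> * of_nat n \<le> 1/8"
    by metis
  show ?thesis
  proof (intro exI conjI allI)
    let ?Q = "\<lambda>n. fibres (cell_index (sqrt (real n)) (q n))"
    show "real_process constant_paths (rotation \<alpha>)" by (rule real_process_rotation)
    show "stationary_process constant_paths (rotation \<alpha>)" by (rule stationary_rotation)
    show "ergodic_process constant_paths (rotation \<alpha>)" by (rule ergodic_rotation[OF \<alpha>])
    show "distr constant_paths borel (rotation \<alpha> i) = unif01" for i by (rule distr_rotation)
    show "borel_partition (?Q n)" for n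
      by (intro borel_partition_fibres measurable_cell_index)
    show "shrinking_partitions ?Q" by (rule shrinking_partitions_fibres)
    show "autoregression_function constant_paths (rotation \<alpha>) (\<lambda>x. frac (x + \<alpha>))"
      by (rule autoregression_rotation)
    \<comment> \<open>The bound holds for every \<open>n\<close>: the angle is fixed, and only
      \<open>q n\<close> and the mesh change.\<close>
    show "\<forall>\<^sub>F n in sequentially. \<P>(\<omega> in constant_paths.
        (LINT x|unif01. \<bar>partitioning_estimate (?Q n) n (\<lambda>i. rotation \<alpha> i \<omega>) x - frac (x + \<alpha>)\<bar>) \<ge> 1/16) \<ge> 1/8"
      using q rotation_error by (intro always_eventually allI) blast
  qed
qed

end
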